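(* Let $d\ge 3$ and $w\ge d+1$ be integers. Then $\kappa(d,w)=\infty$, i.e. there are infinitely many pairwise non-equivalent $d$-dimensional convex lattice polytopes $P$ in $\mathbb{E}^d$ containing exactly $w$ lattice points.
   Context: A convex lattice polytope in $\mathbb{E}^d$ is the convex hull of a finite subset of the integer lattice $\mathbb{Z}^d$; it is called $d$-dimensional if it has non-empty interior. Let $|P|$ denote the cardinality of $P\cap\mathbb{Z}^d$. Two $d$-dimensional convex lattice polytopes $P_1,P_2$ are equivalent if there is an affine transformation $\sigma$ of $\mathbb{E}^d$ with $\sigma(\mathbb{Z}^d)=\mathbb{Z}^d$ and $\sigma(P_1)=P_2$. $\kappa(d,w)$ denotes the number of equivalence classes of $d$-dimensional convex lattice polytopes $P$ with $|P|=w$. *)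

theory Defs
  imports "HOL-Analysis.Analysis" "HOL-Library.Extended_Nat"
begin

definition integer_lattice :: "(real ^ 'n) set" where
  "integer_lattice = {x. \<forall>i. x $ i \<in> \<int>}"

definition lattice_polytope :: "(real ^ 'n) set \<Rightarrow> bool" where
  "lattice_polytope P \<longleftrightarrow>
     (\<exists>S. finite S \<and> S \<subseteq> integer_lattice \<and> P = convex hull S)"

definition full_dimensional :: "(real ^ 'n) set \<Rightarrow> bool" where
  "full_dimensional P \<longleftrightarrow> interior P \<noteq> {}"

definition lattice_point_count :: "(real ^ 'n) set \<Rightarrow> nat" where
  "lattice_point_count P = card (P \<inter> integer_lattice)"

definition affine_transformation :: "(real ^ 'n \<Rightarrow> real ^ 'n) \<Rightarrow> bool" where
  "affine_transformation \<sigma> \<longleftrightarrow>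
     (\<exists>A b. invertible A \<and> \<sigma> = (\<lambda>x. A *v x + b))"

definition lattice_equivalent :: "(real ^ 'n) set \<Rightarrow> (real ^ 'n) set \<Rightarrow> bool" where
  "lattice_equivalent P Q \<longleftrightarrow>
     (\<exists>\<sigma>. affine_transformation \<sigma> \<and> \<sigma> ` integer_lattice = integer_lattice \<and> \<sigma> ` P = Q)"

definition lattice_polytopes :: "nat \<Rightarrow> (real ^ 'n) set set" where
  "lattice_polytopes w =
     {P. lattice_polytope P \<and> full_dimensional P \<and> lattice_point_count P = w}"

definition equivalence_on :: "(real ^ 'n) set set \<Rightarrow> (real ^ 'n) set rel" where
  "equivalence_on \<P> = {(P, Q). P \<in> \<P> \<and> Q \<in> \<P> \<and> lattice_equivalent P Q}"

(* The dimension d is CARD('n); the type argument only selects 'n. *)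
definition kappa :: "'n::finite itself \<Rightarrow> nat \<Rightarrow> enat" where
  "kappa _ w =
     (let C = lattice_polytopes w // equivalence_on (lattice_polytopes w :: (real ^ 'n) set set)
      in if finite C then enat (card C) else \<infinity>)"

lemma lattice_equivalent_refl: "lattice_equivalent P P"
proof -
  have "affine_transformation (\<lambda>x. x :: real ^ 'n)"
    unfolding affine_transformation_def
    by (intro exI[of _ "mat 1"] exI[of _ 0]) (auto simp: invertible_def)
  then show ?thesis
    unfolding lattice_equivalent_def by (intro exI[of _ "\<lambda>x. x"]) auto
qed

lemma lattice_equivalent_sym:
  assumes "lattice_equivalent P Q"
  shows "lattice_equivalent Q P"
proof -
  obtain A b where A: "invertible A"
    and L: "(\<lambda>x. A *v x + b) ` integer_lattice = integer_lattice"
    and Q: "(\<lambda>x. A *v x + b) ` P = Q"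
    using assms unfolding lattice_equivalent_def affine_transformation_def by blast
  obtain B where AB: "A ** B = mat 1" and BA: "B ** A = mat 1"
    using A unfolding invertible_def by blast
  define \<tau> where "\<tau> = (\<lambda>x. B *v x + - (B *v b))"
  have inverse: "\<tau> (A *v x + b) = x" for x
    by (simp add: \<tau>_def matrix_vector_right_distrib matrix_vector_mul_assoc BA)
  have undo: "\<tau> ` (\<lambda>x. A *v x + b) ` X = X" for X
    by (simp add: image_image inverse)
  have "invertible B"
    using AB BA unfolding invertible_def by blast
  then have "affine_transformation \<tau>"
    unfolding affine_transformation_def \<tau>_def by blast
  moreover have "\<tau> ` integer_lattice = integer_lattice"
    using undo[of integer_lattice] by (simp only: L)
  moreover have "\<tau> ` Q = P"
    using undo[of P] by (simp only: Q)
  ultimately show ?thesis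
    unfolding lattice_equivalent_def by blast
qed

lemma lattice_equivalent_trans:
  assumes "lattice_equivalent P Q" and "lattice_equivalent Q R"
  shows "lattice_equivalent P R"
proof -
  obtain \<sigma> where \<sigma>: "affine_transformation \<sigma>"
    "\<sigma> ` integer_lattice = integer_lattice" "\<sigma> ` P = Q"
    using assms(1) unfolding lattice_equivalent_def by blast
  obtain \<tau> where \<tau>: "affine_transformation \<tau>"
    "\<tau> ` integer_lattice = integer_lattice" "\<tau> ` Q = R"
    using assms(2) unfolding lattice_equivalent_def by blast
  obtain A a where A: "invertible A" "\<sigma> = (\<lambda>x. A *v x + a)"
    using \<sigma>(1) unfolding affine_transformation_def by blast
  obtain B b where B: "invertible B" "\<tau> = (\<lambda>x. B *v x + b)"
    using \<tau>(1) unfolding affine_transformation_def by blast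
  have "\<tau> \<circ> \<sigma> = (\<lambda>x. (B ** A) *v x + (B *v a + b))"
    by (simp add: A B fun_eq_iff matrix_vector_right_distrib matrix_vector_mul_assoc add.assoc)
  then have "affine_transformation (\<tau> \<circ> \<sigma>)"
    unfolding affine_transformation_def using invertible_mult[OF B(1) A(1)] by blast
  moreover have "(\<tau> \<circ> \<sigma>) ` integer_lattice = integer_lattice" "(\<tau> \<circ> \<sigma>) ` P = R"
    by (simp_all only: image_comp [symmetric] \<sigma> \<tau>)
  ultimately show ?thesis
    unfolding lattice_equivalent_def by blast
qed

lemma equiv_equivalence_on: "equiv \<P> (equivalence_on \<P>)"
  by (rule equivI)
    (auto simp: equivalence_on_def refl_on_def sym_def trans_def
      intro: lattice_equivalent_refl lattice_equivalent_sym lattice_equivalent_trans)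

end

theory Submission
  imports Defs
begin

text \<open>
  Fix three coordinates \<open>a\<close>, \<open>b\<close>, \<open>c\<close> and put \<open>k = w - d\<close>. For \<open>h \<ge> 1\<close>, consider the simplex whose
  vertices are \<open>0\<close>, \<open>k e\<^sub>b\<close>, \<open>e\<^sub>a + e\<^sub>b + h e\<^sub>c\<close> and the remaining \<open>d - 2\<close> basis vectors, \<open>e\<^sub>a\<close> among
  them. Its lattice points are its vertices and the points of the edge from \<open>0\<close> to \<open>k e\<^sub>b\<close>: the
  coordinates other than \<open>a\<close>, \<open>b\<close>, \<open>c\<close> force a lattice point to be a vertex or to lie in the span
  of \<open>e\<^sub>a\<close>, \<open>e\<^sub>b\<close>, \<open>e\<^sub>c\<close>; the face there lies between the planes \<open>x\<^sub>a = 0\<close> and \<open>x\<^sub>a = 1\<close> and meets each of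
  them in an edge. So there are \<open>k + d = w\<close> lattice points for every \<open>h\<close>, while the determinant \<open>k h\<close> of
  the edge vectors at \<open>0\<close>, which lattice equivalences preserve up to sign, is unbounded. This
  generalises Reeve's tetrahedra.
\<close>

section \<open>Unimodularity of affine maps preserving the lattice\<close>

lemma det_in_Ints:
  fixes A :: "real ^ 'n ^ 'n"
  assumes "\<And>i j. A $ i $ j \<in> \<int>"
  shows "det A \<in> \<int>"
  unfolding det_def using assms by (intro Ints_sum Ints_mult Ints_prod) auto

text \<open>Column \<open>j\<close> of \<open>A\<close> is the difference of the images of two
  lattice points, \<open>axis j 1\<close> and \<open>0\<close>, so the translation cancels.\<close>

lemma affine_lattice_map_entries_in_Ints:
  fixes A :: "real ^ 'n ^ 'n"
  assumes "(\<lambda>x. A *v x + b) ` integer_lattice \<subseteq> integer_lattice"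
  shows "A $ i $ j \<in> \<int>"
proof -
  have "axis j 1 \<in> integer_lattice" "0 \<in> integer_lattice"
    by (auto simp: integer_lattice_def axis_def)
  then have "A *v axis j 1 + b \<in> integer_lattice" "A *v 0 + b \<in> integer_lattice"
    using assms by blast+
  then have "(A *v axis j 1 + b) $ i - (A *v 0 + b) $ i \<in> \<int>"
    unfolding integer_lattice_def by (blast intro: Ints_diff)
  then show ?thesis
    by (simp add: matrix_vector_mult_basis column_def)
qed

text \<open>The inverse map preserves the lattice too, so both determinants are integers, with
  product 1.\<close>

lemma abs_det_affine_lattice_map:
  fixes A :: "real ^ 'n ^ 'n"
  assumes "invertible A" "(\<lambda>x. A *v x + b) ` integer_lattice = integer_lattice"
  shows "\<bar>det A\<bar> = 1"
proof -
  obtain B where AB: "A ** B = mat 1" and BA: "B ** A = mat 1"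
    using assms(1) unfolding invertible_def by blast
  have "(\<lambda>y. B *v y + - (B *v b)) ` (\<lambda>x. A *v x + b) ` integer_lattice = integer_lattice"
    by (simp add: image_image matrix_vector_right_distrib matrix_vector_mul_assoc BA)
  then have B: "(\<lambda>y. B *v y + - (B *v b)) ` integer_lattice = integer_lattice"
    by (simp only: assms(2))
  have "det A \<in> \<int>" "det B \<in> \<int>"
    using affine_lattice_map_entries_in_Ints[OF equalityD1[OF assms(2)]]
      affine_lattice_map_entries_in_Ints[OF equalityD1[OF B]] by (auto intro: det_in_Ints)
  then obtain m n where "det A = of_int m" "det B = of_int n"
    by (auto elim!: Ints_cases)
  moreover have "det A * det B = 1"
    using AB by (metis det_mul det_I)
  ultimately have "m * n = 1" "det A = of_int m"
    by (metis of_int_mult of_int_eq_1_iff, simp)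
  then show ?thesis
    by (auto simp: zmult_eq_1_iff)
qed

section \<open>The standard simplex and its affine self-maps\<close>

abbreviation std_simplex_cart :: "(real ^ 'n) set" where
  "std_simplex_cart \<equiv> convex hull (insert 0 Basis)"

lemma mem_std_simplex_cart:
  "(x :: real ^ 'n) \<in> std_simplex_cart \<longleftrightarrow> (\<forall>i. 0 \<le> x $ i) \<and> (\<Sum>i\<in>UNIV. x $ i) \<le> 1"
proof -
  have "(\<Sum>u\<in>Basis. x \<bullet> u) = (\<Sum>u\<in>range (\<lambda>i. axis i 1). x \<bullet> u)"
    by (rule sum.cong) (auto simp: Basis_vec_def)
  also have "\<dots> = (\<Sum>i\<in>UNIV. x $ i)"
    by (subst sum.reindex) (auto simp: inj_on_def axis_eq_axis inner_axis)
  finally have "(\<Sum>u\<in>Basis. x \<bullet> u) = (\<Sum>i\<in>UNIV. x $ i)" .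
  moreover have "(\<forall>u\<in>Basis. 0 \<le> x \<bullet> u) \<longleftrightarrow> (\<forall>i. 0 \<le> x $ i)"
    by (auto simp: Basis_vec_def inner_axis)
  ultimately show ?thesis
    by (simp add: std_simplex)
qed

lemma std_simplex_cart_eq_axis:
  assumes x: "(x :: real ^ 'n) \<in> std_simplex_cart" and "x $ i = 1"
  shows "x = axis i 1"
proof -
  have "x $ j = 0" if "j \<noteq> i" for j
  proof -
    have "(\<Sum>l\<in>{i, j}. x $ l) \<le> (\<Sum>l\<in>UNIV. x $ l)"
      using x by (intro sum_mono2) (auto simp: mem_std_simplex_cart)
    then show ?thesis
      using x that \<open>x $ i = 1\<close> by (auto simp: mem_std_simplex_cart intro: antisym)
  qed
  then show ?thesis
    using \<open>x $ i = 1\<close> by (auto simp: vec_eq_iff axis_def)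
qed

lemma std_simplex_cart_component:
  assumes "(x :: real ^ 'n) \<in> std_simplex_cart"
  shows "x $ i \<in> {0..1}"
proof -
  have "x $ i \<le> (\<Sum>j\<in>UNIV. x $ j)"
    using assms by (intro member_le_sum) (auto simp: mem_std_simplex_cart)
  then show ?thesis
    using assms by (auto simp: mem_std_simplex_cart)
qed

text \<open>A crude bound from the Leibniz formula; it serves as a bound on all powers of one
  determinant at once.\<close>

lemma abs_det_le_if_entries_bounded:
  fixes A :: "real ^ 'n ^ 'n"
  assumes "\<And>i j. \<bar>A $ i $ j\<bar> \<le> 1"
  shows "\<bar>det A\<bar> \<le> fact CARD('n)"
proof -
  have "\<bar>det A\<bar> \<le> (\<Sum>p | p permutes (UNIV :: 'n set). \<bar>of_int (sign p) * (\<Prod>i\<in>UNIV. A $ i $ p i)\<bar>)"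
    unfolding det_def by (rule sum_abs)
  also have "\<dots> \<le> (\<Sum>p | p permutes (UNIV :: 'n set). 1)"
    using assms by (intro sum_mono) (auto simp: abs_mult abs_prod sign_def intro!: prod_le_1)
  also have "\<dots> = fact CARD('n)"
    using card_permutations[of "UNIV :: 'n set" "CARD('n)"] by simp
  finally show ?thesis .
qed

text \<open>The iterates of such a map also preserve the simplex, so their matrices have bounded entries
  and the powers of the determinant stay bounded.\<close>

lemma abs_det_affine_map_std_simplex_cart:
  fixes N :: "real ^ 'n ^ 'n"
  assumes maps: "(\<lambda>x. N *v x + t) ` std_simplex_cart \<subseteq> std_simplex_cart"
  shows "\<bar>det N\<bar> \<le> 1"
proof -
  have iterate: "\<exists>(B :: real ^ 'n ^ 'n) u. det B = det N ^ m \<and>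
      (\<forall>x\<in>std_simplex_cart. B *v x + u \<in> std_simplex_cart)" for m
  proof (induction m)
    case 0
    show ?case
      by (intro exI[of _ "mat 1"] exI[of _ 0]) simp
  next
    case (Suc m)
    then obtain B :: "real ^ 'n ^ 'n" and u where B: "det B = det N ^ m"
      "\<And>x. x \<in> std_simplex_cart \<Longrightarrow> B *v x + u \<in> std_simplex_cart"
      by blast
    have "(N ** B) *v x + (N *v u + t) \<in> std_simplex_cart" if "x \<in> std_simplex_cart" for x
    proof -
      have "N *v (B *v x + u) + t \<in> std_simplex_cart"
        using maps B(2)[OF that] by blast
      then show ?thesis
        by (simp add: matrix_vector_right_distrib matrix_vector_mul_assoc add.assoc)
    qed
    moreover have "det (N ** B) = det N ^ Suc m"
      by (simp add: det_mul B(1))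
    ultimately show ?case
      by blast
  qed
  have bounded: "\<bar>det N\<bar> ^ m \<le> fact CARD('n)" for m
  proof -
    obtain B :: "real ^ 'n ^ 'n" and u where B: "det B = det N ^ m"
      "\<And>x. x \<in> std_simplex_cart \<Longrightarrow> B *v x + u \<in> std_simplex_cart"
      using iterate by blast
    \<comment> \<open>The entry is a difference of coordinates of the images of two vertices,
      \<open>axis j 1\<close> and \<open>0\<close>, and both coordinates lie in [0,1].\<close>
    have "\<bar>B $ i $ j\<bar> \<le> 1" for i j
    proof -
      have "B *v axis j 1 + u \<in> std_simplex_cart" "B *v 0 + u \<in> std_simplex_cart"
        by (intro B(2) hull_inc; simp)+
      then have "(B *v axis j 1 + u) $ i \<in> {0..1}" "(B *v 0 + u) $ i \<in> {0..1}"
        using std_simplex_cart_component by blast+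
      then show ?thesis
        by (auto simp: matrix_vector_mult_basis column_def)
    qed
    then show ?thesis
      using abs_det_le_if_entries_bounded[of B] by (simp add: B(1) power_abs)
  qed
  show ?thesis
  proof (rule ccontr)
    assume "\<not> \<bar>det N\<bar> \<le> 1"
    then obtain m where "fact CARD('n) < \<bar>det N\<bar> ^ m"
      using real_arch_pow[of "\<bar>det N\<bar>"] by auto
    then show False
      using bounded[of m] by simp
  qed
qed

text \<open>Conjugating the equivalence back to the standard simplex gives a self-map with linear
  part \<open>B ** A ** M\<close>, where \<open>B\<close> inverts \<open>M'\<close>. Its determinant
  is at most 1 in absolute value, and \<open>A\<close> is unimodular.\<close>

lemma abs_det_le_if_lattice_equivalent:
  fixes M M' :: "real ^ 'n ^ 'n"
  assumes "lattice_equivalent ((*v) M ` std_simplex_cart) ((*v) M' ` std_simplex_cart)"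
    and "invertible M'"
  shows "\<bar>det M\<bar> \<le> \<bar>det M'\<bar>"
proof -
  obtain A b where A: "invertible A"
    and L: "(\<lambda>x. A *v x + b) ` integer_lattice = integer_lattice"
    and Q: "(\<lambda>x. A *v x + b) ` (*v) M ` std_simplex_cart = (*v) M' ` std_simplex_cart"
    using assms(1) unfolding lattice_equivalent_def affine_transformation_def by blast
  obtain B where B: "B ** M' = mat 1"
    using assms(2) unfolding invertible_def by blast
  have "(\<lambda>x. (B ** A ** M) *v x + B *v b) ` std_simplex_cart =
      (*v) B ` (\<lambda>x. A *v x + b) ` (*v) M ` std_simplex_cart"
    by (simp add: image_image matrix_vector_right_distrib matrix_vector_mul_assoc matrix_mul_assoc)
  also have "\<dots> = std_simplex_cart"
    unfolding Q by (simp add: image_image matrix_vector_mul_assoc B)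
  finally have "\<bar>det (B ** A ** M)\<bar> \<le> 1"
    by (intro abs_det_affine_map_std_simplex_cart) auto
  then have "\<bar>det B\<bar> * \<bar>det M\<bar> \<le> 1"
    using abs_det_affine_lattice_map[OF A L] by (simp add: det_mul abs_mult)
  moreover have "\<bar>det B\<bar> * \<bar>det M'\<bar> = 1"
    using B by (metis abs_mult abs_one det_I det_mul)
  ultimately show ?thesis
    by (metis abs_ge_zero mult_le_cancel_left_pos mult_zero_left order_le_less zero_neq_one)
qed

section \<open>Generalised Reeve simplices\<close>

definition reeve_matrix :: "'n \<Rightarrow> 'n \<Rightarrow> 'n \<Rightarrow> nat \<Rightarrow> nat \<Rightarrow> real ^ 'n ^ 'n" where
  "reeve_matrix a b c k h =
     (\<chi> i. if i = a then axis a 1 + axis c 1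
           else if i = b then axis b (real k) + axis c 1
           else if i = c then axis c (real h)
           else axis i 1)"

text \<open>The matrix is written by rows, but the vertices other than the origin are its
  columns.\<close>

definition reeve_simplex :: "'n \<Rightarrow> 'n \<Rightarrow> 'n \<Rightarrow> nat \<Rightarrow> nat \<Rightarrow> (real ^ 'n) set" where
  "reeve_simplex a b c k h = (*v) (reeve_matrix a b c k h) ` std_simplex_cart"

lemma reeve_matrix_mult_vector:
  "(reeve_matrix a b c k h *v x) $ i =
     (if i = a then x $ a + x $ c
      else if i = b then real k * x $ b + x $ c
      else if i = c then real h * x $ c
      else x $ i)"
  by (simp add: matrix_vector_mul_component reeve_matrix_def inner_axis' inner_add_left)

lemma lattice_polytope_reeve_simplex: "lattice_polytope (reeve_simplex a b c k h)"
  unfolding lattice_polytope_def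
proof (intro exI conjI)
  show "reeve_simplex a b c k h = convex hull ((*v) (reeve_matrix a b c k h) ` insert 0 Basis)"
    unfolding reeve_simplex_def by (rule convex_hull_linear_image) (rule matrix_vector_mul_linear)
  show "(*v) (reeve_matrix a b c k h) ` insert 0 Basis \<subseteq> integer_lattice"
    by (auto simp: integer_lattice_def reeve_matrix_mult_vector Basis_vec_def axis_def)
qed auto

locale distinct_coordinates =
  fixes a b c :: "'n::finite"
  assumes distinct: "a \<noteq> b" "a \<noteq> c" "b \<noteq> c"
begin

lemma det_reeve_matrix:
  assumes "h > 0"
  shows "det (reeve_matrix a b c k h) = real k * real h"
proof -
  \<comment> \<open>Row \<open>c\<close> of the diagonal matrix \<open>D\<close>, divided by
    \<open>h\<close>, is the unit vector of \<open>c\<close>. Adding it to rows \<open>a\<close> and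
    \<open>b\<close> turns \<open>D\<close> into the Reeve matrix.\<close>
  define D :: "real ^ 'n ^ 'n" where
    "D = (\<chi> i. axis i (if i = b then real k else if i = c then real h else 1))"
  define E where "E = (\<chi> i. if i = a then row a D + (1 / real h) *s row c D else row i D)"
  have "reeve_matrix a b c k h = (\<chi> i. if i = b then row b E + (1 / real h) *s row c E else row i E)"
    using assms distinct
    by (auto simp: vec_eq_iff reeve_matrix_def E_def D_def row_def axis_def)
  then have "det (reeve_matrix a b c k h) = det E"
    using det_row_operation[of b c E] distinct by simp
  also have "\<dots> = det D"
    unfolding E_def using det_row_operation[of a c D] distinct by simp
  also have "\<dots> = (\<Prod>i\<in>UNIV. if i = b then real k else if i = c then real h else 1)"
    by (subst det_diagonal) (auto simp: D_def axis_def intro!: prod.cong)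
  also have "\<dots> = (\<Prod>i\<in>{b, c}. if i = b then real k else if i = c then real h else 1)"
    by (rule prod.mono_neutral_right) auto
  finally show ?thesis
    using distinct by simp
qed

lemma inj_reeve_matrix:
  assumes "k > 0" "h > 0"
  shows "inj ((*v) (reeve_matrix a b c k h))"
  using assms by (intro inj_matrix_vector_mult) (simp add: invertible_det_nz det_reeve_matrix)

lemma full_dimensional_reeve_simplex:
  assumes "k > 0" "h > 0"
  shows "full_dimensional (reeve_simplex a b c k h)"
  unfolding full_dimensional_def reeve_simplex_def
    interior_injective_linear_image[OF matrix_vector_mul_linear inj_reeve_matrix[OF assms]]
  using interior_std_simplex_nonempty[where 'a = "real ^ 'n"] by blast

text \<open>The lattice points are located by their coordinates in the standard simplex. The values
  \<open>j = 0\<close> and \<open>j = k\<close> give the origin and the vertex belonging to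
  \<open>b\<close>, which is why the second family omits \<open>b\<close>.\<close>

lemma reeve_matrix_lattice_preimage:
  assumes "k > 0" "h > 0"
  shows "{x \<in> std_simplex_cart. reeve_matrix a b c k h *v x \<in> integer_lattice} =
    (\<lambda>j. axis b (real j / real k)) ` {..k} \<union> (\<lambda>i. axis i 1) ` (- {b})" (is "?L = ?R")
proof
  have "axis i r \<in> std_simplex_cart" if "0 \<le> r" "r \<le> 1" for i :: 'n and r :: real
    using that by (simp add: mem_std_simplex_cart axis_def)
  moreover have "reeve_matrix a b c k h *v axis b (real j / real k) \<in> integer_lattice" for j
    using assms distinct by (simp add: integer_lattice_def reeve_matrix_mult_vector axis_def)
  moreover have "reeve_matrix a b c k h *v axis i 1 \<in> integer_lattice" for i
    by (simp add: integer_lattice_def reeve_matrix_mult_vector axis_def)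
  ultimately show "?R \<subseteq> ?L"
    using assms by (auto simp: divide_le_eq_1)
  show "?L \<subseteq> ?R"
  proof
    fix x
    assume "x \<in> ?L"
    then have S: "x \<in> std_simplex_cart" and int: "\<And>i. (reeve_matrix a b c k h *v x) $ i \<in> \<int>"
      by (auto simp: integer_lattice_def)
    have nonneg: "0 \<le> x $ i" for i
      using S by (auto simp: mem_std_simplex_cart)
    have sum: "(\<Sum>i\<in>I. x $ i) \<le> 1" for I
      using S sum_mono2[of UNIV I "\<lambda>i. x $ i"] by (auto simp: mem_std_simplex_cart)
    have le1: "x $ i \<le> 1" for i
      using std_simplex_cart_component[OF S] by simp
    have Ints01: "r = 0 \<or> r = 1" if "r \<in> \<int>" "0 \<le> r" "r \<le> 1" for r :: real
      using that by (auto elim!: Ints_cases)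
    show "x \<in> ?R"
    proof (cases "\<exists>i. i \<noteq> b \<and> x $ i = 1")
      case True
      then show ?thesis
        using std_simplex_cart_eq_axis[OF S] by blast
    next
      case False
      \<comment> \<open>The matrix fixes these coordinates, so they are integers in [0,1], and the
        value 1 is excluded by \<open>False\<close>.\<close>
      have other: "x $ i = 0" if "i \<noteq> a" "i \<noteq> b" "i \<noteq> c" for i
        using Ints01[of "x $ i"] int[of i] that nonneg[of i] le1[of i] False
        by (auto simp: reeve_matrix_mult_vector)
      have abc: "x $ a + x $ b + x $ c \<le> 1"
        using sum[of "{a, b, c}"] distinct by (simp add: add.assoc)
      have "x $ a + x $ c = 0 \<or> x $ a + x $ c = 1"
        using int[of a] abc nonneg[of a] nonneg[of b] nonneg[of c]
        by (intro Ints01) (auto simp: reeve_matrix_mult_vector)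
      then have ac: "x $ a = 0 \<and> x $ c = 0"
      proof
        assume "x $ a + x $ c = 0"
        then show ?thesis
          using nonneg[of a] nonneg[of c] by linarith
      next
        \<comment> \<open>Here \<open>x $ b\<close> vanishes, so coordinate \<open>b\<close> of the
          image is \<open>x $ c\<close> alone. Its integrality makes \<open>x $ a\<close> or
          \<open>x $ c\<close> equal to 1, against \<open>False\<close>.\<close>
        assume eq: "x $ a + x $ c = 1"
        then have "x $ b = 0"
          using abc nonneg[of b] by linarith
        then have "x $ c = 0 \<or> x $ c = 1"
          using int[of b] distinct nonneg[of c] le1[of c]
          by (intro Ints01) (auto simp: reeve_matrix_mult_vector)
        then show ?thesis
          using eq False distinct by auto
      qed
      then have "real k * x $ b \<in> \<int>"
        using int[of b] distinct by (auto simp: reeve_matrix_mult_vector)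
      then obtain m where m: "real k * x $ b = of_int m"
        by (auto elim: Ints_cases)
      then have "0 \<le> real_of_int m" "real_of_int m \<le> real k"
        using nonneg[of b] le1[of b] by (simp_all flip: m add: mult_left_le)
      then have "nat m \<in> {..k}" "x $ b = real (nat m) / real k"
        using m assms by (auto simp: field_simps)
      moreover have "x = axis b (x $ b)"
        using ac other by (simp add: vec_eq_iff axis_def) metis
      ultimately show ?thesis
        by (metis UnI1 image_eqI)
    qed
  qed
qed

lemma lattice_point_count_reeve_simplex:
  assumes "k > 0" "h > 0"
  shows "lattice_point_count (reeve_simplex a b c k h) = k + CARD('n)"
proof -
  let ?M = "reeve_matrix a b c k h"
  let ?edge = "(\<lambda>j. axis b (real j / real k) :: real ^ 'n) ` {..k}"
  let ?vertices = "(\<lambda>i. axis i 1 :: real ^ 'n) ` (- {b})"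
  have "reeve_simplex a b c k h \<inter> integer_lattice =
      (*v) ?M ` {x \<in> std_simplex_cart. ?M *v x \<in> integer_lattice}"
    by (auto simp: reeve_simplex_def)
  then have "lattice_point_count (reeve_simplex a b c k h) = card (?edge \<union> ?vertices)"
    unfolding lattice_point_count_def reeve_matrix_lattice_preimage[OF assms]
    by (simp only: card_image[OF inj_on_subset[OF inj_reeve_matrix[OF assms] subset_UNIV]])
  also have "\<dots> = card ?edge + card ?vertices"
    by (rule card_Un_disjoint) (auto simp: axis_eq_axis)
  also have "card ?edge = k + 1"
    using assms by (subst card_image) (auto simp: inj_on_def axis_eq_axis)
  also have "card ?vertices = CARD('n) - 1"
    by (subst card_image) (auto simp: inj_on_def axis_eq_axis Compl_eq_Diff_UNIV)
  finally show ?thesis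
    using zero_less_card_finite[where 'a = 'n] by linarith
qed

end

theorem theorem4:
  fixes w :: nat
  assumes "CARD('n::finite) \<ge> 3"
    and "w \<ge> CARD('n) + 1"
  shows "kappa TYPE('n) w = \<infinity>"
proof -
  obtain T :: "'n set" where "card T = 3"
    using assms(1) obtain_subset_with_card_n by blast
  then obtain a b c :: 'n where "a \<noteq> b" "a \<noteq> c" "b \<noteq> c"
    unfolding card_3_iff by blast
  then interpret distinct_coordinates a b c
    by unfold_locales
  define k where "k = w - CARD('n)"
  have k: "k > 0" "k + CARD('n) = w"
    using assms(2) by (auto simp: k_def)
  let ?L = "lattice_polytopes w :: (real ^ 'n) set set"
  \<comment> \<open>The shift by one keeps the height positive, hence the determinant nonzero, for
    every natural index.\<close>
  let ?P = "\<lambda>h. reeve_simplex a b c k (Suc h)"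
  have P: "?P h \<in> ?L" for h
    using k by (simp add: lattice_polytopes_def lattice_polytope_reeve_simplex
        full_dimensional_reeve_simplex lattice_point_count_reeve_simplex)
  have "inj (\<lambda>h. equivalence_on ?L `` {?P h})"
  proof (rule injI)
    fix g h
    assume "equivalence_on ?L `` {?P g} = equivalence_on ?L `` {?P h}"
    then have "(?P g, ?P h) \<in> equivalence_on ?L"
      using eq_equiv_class[OF _ equiv_equivalence_on P] by blast
    then have "lattice_equivalent (?P g) (?P h)"
      by (simp add: equivalence_on_def)
    \<comment> \<open>The determinant comparison is one-sided, so it is applied in both
      directions.\<close>
    from this lattice_equivalent_sym[OF this]
    have "\<bar>det (reeve_matrix a b c k (Suc g))\<bar> = \<bar>det (reeve_matrix a b c k (Suc h))\<bar>"
      using k(1) unfolding reeve_simplex_def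
      by (intro antisym abs_det_le_if_lattice_equivalent)
        (simp_all add: invertible_det_nz det_reeve_matrix)
    then show "g = h"
      using k(1) by (simp add: det_reeve_matrix)
  qed
  moreover have "range (\<lambda>h. equivalence_on ?L `` {?P h}) \<subseteq> ?L // equivalence_on ?L"
    using P by (auto intro: quotientI)
  ultimately have "infinite (?L // equivalence_on ?L)"
    using finite_subset range_inj_infinite by blast
  then show ?thesis
    by (simp add: kappa_def)
qed

end
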